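(* Let $\Delta\subseteq\mathbb{R}^2$ be the filled triangle with vertices $(0,0)$, $(1,0)$ and $(0,1)$. Let $f_1,f_2:\mathbb{R}^2\to\mathbb{R}^2$ be given by $$f_i(x,y)=A_i\begin{pmatrix}x\\ y\end{pmatrix}+\begin{pmatrix}0\\ i-1\end{pmatrix},\quad i=1,2,\qquad A_1=\begin{pmatrix}1&\tfrac12\\ 0&\tfrac12\end{pmatrix},\quad A_2=\begin{pmatrix}0&\tfrac12\\ -1&-\tfrac12\end{pmatrix}.$$ Then $\Delta$ is a semiattractor of the iterated function system $\mathcal{F}=(\mathbb{R}^2;f_1,f_2)$, and $\Delta$ is strongly-fibred. Moreover, the normalized two-dimensional Lebesgue measure restricted to $\Delta$, $$\mu(B)=\frac{\mathcal{L}(B\cap\Delta)}{\mathcal{L}(\Delta)}=2\mathcal{L}(B\cap\Delta)\quad\text{for Borel }B\subseteq\mathbb{R}^2,$$ is the unique invariant Borel probability measure of the probabilistic iterated function system $\mathcal{F}p=(\mathbb{R}^2;(f_i,p_i):i\in\{1,2\})$ with $p_1=p_2=\tfrac12$.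
   Context: $\mathcal{L}$ denotes two-dimensional Lebesgue measure. For an iterated function system (IFS) $(X;f_i:i\in I)$ of continuous self-maps of a Polish space $X$ ($I$ finite), the Hutchinson operator is $F(S)=\operatorname{cl}\bigcup_{i\in I}f_i(S)$ for $S\subseteq X$ ($\operatorname{cl}$ is topological closure); $F^n$ is its $n$-fold composition and $F^n(x)=F^n(\{x\})$. The lower Kuratowski limit of sets $S_n\subseteq X$ is $\operatorname{Li}S_n=\{y\in X:y=\lim_{n\to\infty}x_n\text{ for some sequence }x_n\in S_n\}$. A nonempty closed set $A_*\subseteq X$ is a semiattractor of the IFS if $\bigcap_{x\in X}\operatorname{Li}F^n(x)=A_*$. A minimal invariant set is a nonempty closed set $A_*$ with $F(A_* )=A_*$ such that no nonempty closed proper subset $C\subsetneq A_*$ satisfies $F(C)=C$. For a compact minimal invariant set $A_*$ (in particular a compact semiattractor), the fibre of $A_*$ with address $i_1i_2\dots\in I^\infty$ is $$\pi(i_1i_2\dots)=\bigcap_{n=1}^\infty f_{i_1}\circ\dots\circ f_{i_n}(A_* ).$$ $A_*$ is strongly-fibred if for every $a\in A_*$ and every open $V\ni a$ there exists $(i_n)_{n=1}^\infty\in I^\infty$ such that $\pi(i_1i_2\dots)\subseteq V$. A Borel probability measure $\nu$ on $X$ is invariant for a probabilistic IFS $(X;(f_i,p_i):i\in I)$ if $\nu=\sum_{i\in I}p_i\cdot\nu\circ f_i^{-1}$, where $\nu\circ f_i^{-1}$ is the push-forward of $\nu$ through $f_i$. *)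

theory Defs
  imports "HOL-Probability.Probability"
begin

definition ifs :: "'i set \<Rightarrow> ('i \<Rightarrow> 'a::polish_space \<Rightarrow> 'a) \<Rightarrow> bool" where
  "ifs I f \<longleftrightarrow> finite I \<and> (\<forall>i\<in>I. continuous_on UNIV (f i))"

definition hutchinson :: "'i set \<Rightarrow> ('i \<Rightarrow> 'a::polish_space \<Rightarrow> 'a) \<Rightarrow> 'a set \<Rightarrow> 'a set" where
  "hutchinson I f S = closure (\<Union>i\<in>I. f i ` S)"

definition lower_kuratowski_limit :: "(nat \<Rightarrow> 'a::topological_space set) \<Rightarrow> 'a set" where
  "lower_kuratowski_limit S = {y. \<exists>x. (\<forall>n. x n \<in> S n) \<and> x \<longlonglongrightarrow> y}"

definition semiattractor :: "'i set \<Rightarrow> ('i \<Rightarrow> 'a::polish_space \<Rightarrow> 'a) \<Rightarrow> 'a set \<Rightarrow> bool" where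
  "semiattractor I f A \<longleftrightarrow> ifs I f \<and> A \<noteq> {} \<and> closed A \<and>
     (\<Inter>x. lower_kuratowski_limit (\<lambda>n. (hutchinson I f ^^ n) {x})) = A"

definition minimal_invariant :: "'i set \<Rightarrow> ('i \<Rightarrow> 'a::polish_space \<Rightarrow> 'a) \<Rightarrow> 'a set \<Rightarrow> bool" where
  "minimal_invariant I f A \<longleftrightarrow> ifs I f \<and> A \<noteq> {} \<and> closed A \<and> hutchinson I f A = A \<and>
     \<not> (\<exists>C. C \<noteq> {} \<and> closed C \<and> C \<subset> A \<and> hutchinson I f C = C)"

text \<open>An address \<open>s\<close> is read from index \<open>1\<close> on; its value at \<open>0\<close> is irrelevant.\<close>

primrec address_comp :: "('i \<Rightarrow> 'a \<Rightarrow> 'a) \<Rightarrow> (nat \<Rightarrow> 'i) \<Rightarrow> nat \<Rightarrow> 'a \<Rightarrow> 'a" where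
  "address_comp f s 0 = id"
| "address_comp f s (Suc n) = address_comp f s n \<circ> f (s (Suc n))"

definition fibre :: "('i \<Rightarrow> 'a \<Rightarrow> 'a) \<Rightarrow> 'a set \<Rightarrow> (nat \<Rightarrow> 'i) \<Rightarrow> 'a set" where
  "fibre f A s = (\<Inter>n\<in>{1..}. address_comp f s n ` A)"

definition strongly_fibred :: "'i set \<Rightarrow> ('i \<Rightarrow> 'a::polish_space \<Rightarrow> 'a) \<Rightarrow> 'a set \<Rightarrow> bool" where
  "strongly_fibred I f A \<longleftrightarrow> compact A \<and> minimal_invariant I f A \<and>
     (\<forall>a\<in>A. \<forall>V. open V \<and> a \<in> V \<longrightarrow> (\<exists>s. (\<forall>n\<ge>1. s n \<in> I) \<and> fibre f A s \<subseteq> V))"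

definition probabilistic_ifs ::
    "'i set \<Rightarrow> ('i \<Rightarrow> 'a::polish_space \<Rightarrow> 'a) \<Rightarrow> ('i \<Rightarrow> real) \<Rightarrow> bool" where
  "probabilistic_ifs I f p \<longleftrightarrow> ifs I f \<and> (\<forall>i\<in>I. p i > 0) \<and> (\<Sum>i\<in>I. p i) = 1"

definition invariant_measure ::
    "'i set \<Rightarrow> ('i \<Rightarrow> 'a::polish_space \<Rightarrow> 'a) \<Rightarrow> ('i \<Rightarrow> real) \<Rightarrow> 'a measure \<Rightarrow> bool" where
  "invariant_measure I f p \<nu> \<longleftrightarrow>
     probabilistic_ifs I f p \<and> sets \<nu> = sets borel \<and> prob_space \<nu> \<and>
     (\<forall>B\<in>sets borel. measure \<nu> B = (\<Sum>i\<in>I. p i * measure (distr \<nu> borel (f i)) B))"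

definition tri_filled :: "(real^2) set" where
  "tri_filled = convex hull {vector [0, 0], vector [1, 0], vector [0, 1]}"

definition tri_matrix :: "nat \<Rightarrow> real^2^2" where
  "tri_matrix i =
     (if i = 1 then vector [vector [1, 1/2], vector [0, 1/2]]
      else vector [vector [0, 1/2], vector [-1, -1/2]])"

definition tri_map :: "nat \<Rightarrow> real^2 \<Rightarrow> real^2" where
  "tri_map i v = tri_matrix i *v v + vector [0, real i - 1]"

definition tri_measure :: "(real^2) measure" where
  "tri_measure = uniform_measure lborel tri_filled"

end

(*
  The two maps cut the triangle along its median into halves of equal area, so normalized Lebesgue
  measure is invariant. Composing any affine map with f_1 or f_2 on the right does not increase the
  perimeter of the image of the triangle, and composing with f_2 f_2 f_2 halves it; hence the average
  perimeter of f_w(triangle) over all words w of length n decays exponentially. Therefore, for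
  bounded Lipschitz g, the averages (P^n g)(x) of g(f_w x) satisfy (P^n g)(x) - (P^n g)(0) -> 0 for
  every x in the plane, so (P^n g)(0) converges to the integral of g against every invariant
  probability measure, which makes that measure unique. Taking for g a bump function around a point a
  of the triangle, the limit is positive and the average perimeter vanishes, so for all large n some
  word of length n maps a prescribed bounded set into a given ball around a. This gives the
  semiattractor property, minimality and strong fibring at once.
*)

theory Submission
  imports Defs
begin

text \<open>Keeps the index \<open>1\<close> of the first map from being rewritten to \<open>Suc 0\<close>.\<close>

declare One_nat_def [simp del]

subsection \<open>Geometry of the triangle\<close>

lemma vector_two_eta: "vector [v $ 1, v $ 2] = (v :: 'a::zero^2)"
  by (simp add: vec_eq_iff forall_2)

lemma tri_map_1: "tri_map 1 v = vector [v $ 1 + v $ 2 / 2, v $ 2 / 2]"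
  and tri_map_2: "tri_map 2 v = vector [v $ 2 / 2, 1 - v $ 1 - v $ 2 / 2]"
  by (simp_all add: tri_map_def tri_matrix_def matrix_vector_mult_def vec_eq_iff forall_2 sum_2)

lemma tri_filled_eq: "tri_filled = {v. 0 \<le> v $ 1 \<and> 0 \<le> v $ 2 \<and> v $ 1 + v $ 2 \<le> 1}"
  unfolding tri_filled_def convex_hull_3_alt
  by (auto simp: vec_eq_iff forall_2) 

text \<open>\<open>tri_map 1\<close> fixes (0,0) and (1,0) and sends (0,1) to (1/2,1/2), the
  midpoint of the hypotenuse. Its image is thus the half of the triangle below the median through
  the right angle.\<close>

lemma tri_map_1_image: "tri_map 1 ` tri_filled = {v \<in> tri_filled. v $ 2 \<le> v $ 1}"
proof
  show "{v \<in> tri_filled. v $ 2 \<le> v $ 1} \<subseteq> tri_map 1 ` tri_filled"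
  proof
    fix v assume v: "v \<in> {v \<in> tri_filled. v $ 2 \<le> v $ 1}"
    show "v \<in> tri_map 1 ` tri_filled"
      \<comment> \<open>The witness is the inverse of \<open>tri_map 1\<close> at
        \<open>v\<close>.\<close>
      using v by (intro image_eqI[where x = "vector [v $ 1 - v $ 2, 2 * v $ 2]"])
        (auto simp: tri_filled_eq tri_map_1 vector_two_eta)
  qed
qed (auto simp: tri_filled_eq tri_map_1)

text \<open>The vertices (0,0), (1,0), (0,1) go to (0,1), (0,0), (1/2,1/2), which span the half
  above the same median.\<close>

lemma tri_map_2_image: "tri_map 2 ` tri_filled = {v \<in> tri_filled. v $ 1 \<le> v $ 2}"
proof
  show "{v \<in> tri_filled. v $ 1 \<le> v $ 2} \<subseteq> tri_map 2 ` tri_filled"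
  proof
    fix v assume v: "v \<in> {v \<in> tri_filled. v $ 1 \<le> v $ 2}"
    show "v \<in> tri_map 2 ` tri_filled"
      using v by (intro image_eqI[where x = "vector [1 - v $ 2 - v $ 1, 2 * v $ 1]"])
        (auto simp: tri_filled_eq tri_map_2 vector_two_eta)
  qed
qed (auto simp: tri_filled_eq tri_map_2)

lemma continuous_on_tri_map: "continuous_on S (tri_map i)"
  unfolding tri_map_def
  by (intro continuous_intros)

lemma measurable_tri_map [measurable]: "tri_map i \<in> borel_measurable borel"
  by (intro borel_measurable_continuous_onI continuous_on_tri_map)

lemma ifs_tri_map: "ifs {1, 2} tri_map"
  by (simp add: ifs_def continuous_on_tri_map)

lemma probabilistic_ifs_tri_map: "probabilistic_ifs {1, 2::nat} tri_map (\<lambda>_. 1/2)"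
  by (simp add: probabilistic_ifs_def ifs_tri_map)

lemma compact_tri_filled: "compact tri_filled"
  unfolding tri_filled_def by (intro finite_imp_compact_convex_hull) simp

lemma tri_filled_in_borel [measurable, simp]: "tri_filled \<in> sets borel"
  by (intro borel_closed compact_imp_closed compact_tri_filled)

section \<open>Normalized Lebesgue measure on the triangle and its invariance\<close>

lemma measure_tri_filled: "measure lborel tri_filled = 1/2"
  unfolding tri_filled_def by (simp add: content_triangle)

lemma emeasure_tri_filled: "emeasure lborel tri_filled = ennreal (1/2)"
  using emeasure_eq_ennreal_measure[of lborel tri_filled]
    emeasure_bounded_finite[OF compact_imp_bounded[OF compact_tri_filled]]
  by (simp add: measure_tri_filled less_top)

lemma measure_tri_measure:
  assumes "B \<in> sets borel"
  shows "measure tri_measure B = 2 * measure lborel (B \<inter> tri_filled)"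
  using assms unfolding tri_measure_def
  by (subst measure_uniform_measure) (simp_all add: emeasure_tri_filled measure_tri_filled Int_commute)

lemma sets_tri_measure: "sets tri_measure = sets borel"
  by (simp add: tri_measure_def)

lemma prob_space_tri_measure: "prob_space tri_measure"
  unfolding tri_measure_def by (intro prob_space_uniform_measure) (simp_all add: emeasure_tri_filled)

lemma det_tri_matrix: "det (tri_matrix i) = 1/2"
  by (simp add: det_2 tri_matrix_def)

text \<open>Both linear parts have determinant 1/2, and translations preserve area.\<close>

lemma measure_tri_map_image:
  assumes B: "B \<in> sets borel" "bounded B" and im: "tri_map i ` B \<in> sets borel"
  shows "measure lborel (tri_map i ` B) = measure lborel B / 2"
proof -
  have B': "B \<in> lmeasurable"
    using B by (intro bounded_set_imp_lmeasurable) auto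
  have "tri_map i ` B = (+) (vector [0, real i - 1]) ` (*v) (tri_matrix i) ` B"
    unfolding image_image tri_map_def by (simp add: add.commute)
  then have "measure lebesgue (tri_map i ` B) = \<bar>det (matrix ((*v) (tri_matrix i)))\<bar> * measure lebesgue B"
    by (simp only: measure_translation measure_linear_image[OF matrix_vector_mul_linear B'])
  then show ?thesis
    using B im by (simp add: det_tri_matrix)
qed

text \<open>The median splits \<open>B \<inter> tri_filled\<close> into its parts in the two image
  triangles. The part in the image of \<open>tri_map i\<close> has half the area of the preimage of
  \<open>B\<close> in the triangle, so adding the parts gives the invariance equation.\<close>

lemma invariant_tri_measure: "invariant_measure {1, 2} tri_map (\<lambda>_. 1/2) tri_measure"
proof -
  have "measure tri_measure B = 
      (measure tri_measure (tri_map 1 -` B) + measure tri_measure (tri_map 2 -` B)) / 2"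
    if B: "B \<in> sets borel" for B
  proof -
    have vim [measurable]: "tri_map i -` B \<in> sets borel" for i
      using measurable_sets[OF measurable_tri_map B] by simp
    have fin: "bounded A \<Longrightarrow> A \<in> sets borel \<Longrightarrow> A \<in> fmeasurable lborel" for A :: "(real^2) set"
      using emeasure_bounded_finite[of A] by (simp add: fmeasurable_def)
    have bnd: "bounded (A \<inter> tri_filled)" for A
      using compact_imp_bounded[OF compact_tri_filled] by (rule bounded_subset) auto
    have im_borel: "tri_map i ` tri_filled \<in> sets borel" for i
      by (intro borel_closed compact_imp_closed compact_continuous_image continuous_on_tri_map
          compact_tri_filled)
    have half: "measure lborel (B \<inter> tri_map i ` tri_filled) =
        measure lborel ((tri_map i -` B) \<inter> tri_filled) / 2" for i
    proof -
      have eq: "B \<inter> tri_map i ` tri_filled = tri_map i ` ((tri_map i -` B) \<inter> tri_filled)"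
        by auto
      have "tri_map i ` ((tri_map i -` B) \<inter> tri_filled) \<in> sets borel"
        unfolding eq[symmetric] using B im_borel by simp
      then show ?thesis
        unfolding eq using bnd by (intro measure_tri_map_image) auto
    qed
    let ?S = "\<lambda>i. B \<inter> tri_map i ` tri_filled"
    have null: "measure lborel (?S 1 \<inter> ?S 2) = 0"
    proof -
      \<comment> \<open>The two images overlap only on the diagonal, a line with normal vector
        (1,-1).\<close>
      have "negligible {v :: real^2. vector [1, -1] \<bullet> v = 0}"
        by (rule negligible_hyperplane) (simp add: vec_eq_iff forall_2)
      moreover have "?S 1 \<inter> ?S 2 \<subseteq> {v. vector [1, -1] \<bullet> v = 0}"
        unfolding tri_map_1_image tri_map_2_image by (auto simp: inner_vec_def sum_2)
      ultimately have "negligible (?S 1 \<inter> ?S 2)"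
        by (rule negligible_subset)
      then have "measure lebesgue (?S 1 \<inter> ?S 2) = 0"
        by (simp add: negligible_imp_measure0)
      then show ?thesis
        using B im_borel by simp
    qed
    have sub: "tri_map i ` tri_filled \<subseteq> tri_filled" if "i \<in> {1, 2}" for i
      using that tri_map_1_image tri_map_2_image by auto
    have fm: "?S i \<in> fmeasurable lborel" if "i \<in> {1, 2}" for i
      using B im_borel sub[OF that] bnd[of B]
      by (intro fin) (auto intro: bounded_subset)
    have "measure lborel (B \<inter> tri_filled) = measure lborel (?S 1 \<union> ?S 2)"
      unfolding tri_map_1_image tri_map_2_image by (rule arg_cong) auto
    also have "\<dots> = measure lborel (?S 1) + measure lborel (?S 2)"
      using null measure_Un3[OF fm fm, of 1 2] by simp
    finally show ?thesis
      using B vim by (simp add: measure_tri_measure half)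
  qed
  moreover have "measure (distr tri_measure borel (tri_map i)) B = measure tri_measure (tri_map i -` B)"
    if "B \<in> sets borel" for i B
    using that by (subst measure_distr) (simp_all add: tri_measure_def)
  ultimately show ?thesis
    by (simp add: invariant_measure_def probabilistic_ifs_tri_map sets_tri_measure
        prob_space_tri_measure add_divide_distrib)
qed

text \<open>A convex set with nonempty interior lies in the closure of that interior, so
  \<open>V\<close> meets the interior of the triangle in a nonempty open set, which has positive
  area.\<close>

lemma emeasure_tri_measure_pos:
  assumes "open V" "V \<inter> tri_filled \<noteq> {}"
  shows "emeasure tri_measure V > 0"
proof -
  have "convex tri_filled"
    by (simp add: tri_filled_def)
  have "interior tri_filled \<noteq> {}"
  proof
    assume "interior tri_filled = {}"
    then have "negligible tri_filled"
      using \<open>convex tri_filled\<close> negligible_convex_interior by blast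
    then have "measure lebesgue tri_filled = 0"
      by (rule negligible_imp_measure0)
    then show False
      using measure_tri_filled by simp
  qed
  then have "tri_filled \<subseteq> closure (interior tri_filled)"
    using convex_closure_interior[OF \<open>convex tri_filled\<close>] closure_subset by blast
  then have "V \<inter> interior tri_filled \<noteq> {}"
    using assms open_Int_closure_eq_empty by fastforce
  then have "\<not> negligible (V \<inter> interior tri_filled)"
    using assms by (intro open_not_negligible) auto
  then have nn: "\<not> negligible (V \<inter> tri_filled)"
    using interior_subset negligible_subset by (metis Int_mono order_refl)
  have "emeasure lborel (V \<inter> tri_filled) \<noteq> 0"
  proof
    assume "emeasure lborel (V \<inter> tri_filled) = 0"
    then have "V \<inter> tri_filled \<in> null_sets lebesgue"
      using assms(1) by (intro null_sets_completionI) auto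
    then show False
      using nn negligible_iff_null_sets by blast
  qed
  then show ?thesis
    unfolding tri_measure_def using assms(1)
    by (simp add: emeasure_tri_filled Int_commute zero_less_iff_neq_zero ennreal_divide_eq_0_iff)
qed

subsection \<open>Invariant measures\<close>

text \<open>Invariance is defined on Borel sets; it passes to functions by induction from indicators
  over sums and multiples to monotone limits.\<close>

lemma nn_integral_invariant_measure:
  assumes "invariant_measure I f p \<nu>" and g: "g \<in> borel_measurable borel"
  shows "(\<integral>\<^sup>+x. g x \<partial>\<nu>) = (\<Sum>i\<in>I. ennreal (p i) * (\<integral>\<^sup>+x. g (f i x) \<partial>\<nu>))"
proof -
  interpret prob_space \<nu>
    using assms by (simp add: invariant_measure_def)
  have sets_nu [measurable_cong, simp]: "sets \<nu> = sets borel"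
    using assms by (simp add: invariant_measure_def)
  have sp [simp]: "space \<nu> = UNIV"
    using sets_eq_imp_space_eq[OF sets_nu] by simp
  have fin: "finite I" and p: "\<And>i. i \<in> I \<Longrightarrow> p i > 0" and
    cont: "\<And>i. i \<in> I \<Longrightarrow> continuous_on UNIV (f i)"
    using assms by (auto simp: invariant_measure_def probabilistic_ifs_def ifs_def)
  have f [measurable]: "f i \<in> borel_measurable borel" if "i \<in> I" for i
    using cont[OF that] by (rule borel_measurable_continuous_onI)
  have f' [measurable]: "f i \<in> borel_measurable \<nu>" if "i \<in> I" for i
    using f[OF that] by measurable
  show ?thesis
    using g
  proof induction
    case (cong u v)
    then show ?case by simp
  next
    case (set A)
    have "emeasure \<nu> A = ennreal (\<Sum>i\<in>I. p i * measure (distr \<nu> borel (f i)) A)"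
      using assms set by (simp add: emeasure_eq_measure invariant_measure_def)
    \<comment> \<open>The push-forwards are probability measures, so their \<open>measure\<close>
      and \<open>emeasure\<close> agree.\<close>
    also have "\<dots> = (\<Sum>i\<in>I. ennreal (p i) * emeasure (distr \<nu> borel (f i)) A)"
    proof -
      have "emeasure (distr \<nu> borel (f i)) A = ennreal (measure (distr \<nu> borel (f i)) A)" if "i \<in> I" for i
      proof -
        interpret D: prob_space "distr \<nu> borel (f i)"
          using f'[OF that] by (rule prob_space_distr)
        show ?thesis by (rule D.emeasure_eq_measure)
      qed
      then show ?thesis
        using p by (simp add: less_imp_le ennreal_mult flip: sum_ennreal)
    qed
    also have "\<dots> = (\<Sum>i\<in>I. ennreal (p i) * (\<integral>\<^sup>+x. indicator A (f i x) \<partial>\<nu>))"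
    proof (intro sum.cong refl arg_cong2[where f = "(*)"])
      fix i assume i: "i \<in> I"
      have "emeasure (distr \<nu> borel (f i)) A = (\<integral>\<^sup>+x. indicator A x \<partial>distr \<nu> borel (f i))"
        using set by simp
      also have "\<dots> = (\<integral>\<^sup>+x. indicator A (f i x) \<partial>\<nu>)"
        using f'[OF i] set by (intro nn_integral_distr) auto
      finally show "emeasure (distr \<nu> borel (f i)) A = (\<integral>\<^sup>+x. indicator A (f i x) \<partial>\<nu>)" .
    qed
    finally show ?case
      using set by simp
  next
    case (mult u c)
    note [measurable] = mult.hyps(2)
    have "(\<integral>\<^sup>+x. c * u (f i x) \<partial>\<nu>) = c * (\<integral>\<^sup>+x. u (f i x) \<partial>\<nu>)" if "i \<in> I" for i
      using that by (intro nn_integral_cmult) measurable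
    moreover have "(\<integral>\<^sup>+x. c * u x \<partial>\<nu>) = c * (\<integral>\<^sup>+x. u x \<partial>\<nu>)"
      by (intro nn_integral_cmult) measurable
    ultimately show ?case
      using mult by (simp add: sum_distrib_left mult.left_commute)
  next
    case (add u v)
    note [measurable] = add.hyps(1) add.hyps(3)
    have "(\<integral>\<^sup>+x. v (f i x) + u (f i x) \<partial>\<nu>) = (\<integral>\<^sup>+x. v (f i x) \<partial>\<nu>) + (\<integral>\<^sup>+x. u (f i x) \<partial>\<nu>)"
      if "i \<in> I" for i
      using that by (intro nn_integral_add) measurable
    moreover have "(\<integral>\<^sup>+x. v x + u x \<partial>\<nu>) = (\<integral>\<^sup>+x. v x \<partial>\<nu>) + (\<integral>\<^sup>+x. u x \<partial>\<nu>)"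
      by (intro nn_integral_add) measurable
    ultimately show ?case
      using add by (simp add: distrib_left sum.distrib)
  next
    case (seq U)
    note [measurable] = seq.hyps(1)
    have sup: "(\<integral>\<^sup>+x. (SUP n. U n (f i x)) \<partial>\<nu>) = (SUP n. \<integral>\<^sup>+x. U n (f i x) \<partial>\<nu>)" if "i \<in> I" for i
      using that incseqD[OF seq.hyps(3)]
      by (intro nn_integral_monotone_convergence_SUP) (auto simp: mono_def le_fun_def)
    have "(\<integral>\<^sup>+x. (SUP n. U n x) \<partial>\<nu>) = (SUP n. \<integral>\<^sup>+x. U n x \<partial>\<nu>)"
      using seq.hyps(3) by (intro nn_integral_monotone_convergence_SUP) auto
    also have "\<dots> = (SUP n. \<Sum>i\<in>I. ennreal (p i) * (\<integral>\<^sup>+x. U n (f i x) \<partial>\<nu>))"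
      using seq.IH by simp
    also have "\<dots> = (\<Sum>i\<in>I. (SUP n. ennreal (p i) * (\<integral>\<^sup>+x. U n (f i x) \<partial>\<nu>)))"
      using seq.hyps(3)
      by (intro incseq_sumI2 ennreal_SUP_sum)
        (auto simp: mono_def le_fun_def intro!: mult_left_mono nn_integral_mono)
    also have "\<dots> = (\<Sum>i\<in>I. ennreal (p i) * (\<integral>\<^sup>+x. (SUP n. U n (f i x)) \<partial>\<nu>))"
      by (simp add: sup SUP_mult_left_ennreal)
    finally show ?case
      by (simp add: image_comp)
  qed
qed

text \<open>Bounds on \<open>g\<close> make all integrals finite, so the extended identity can be
  read in the reals.\<close>

lemma integral_invariant_measure:
  fixes g :: "'a::polish_space \<Rightarrow> real"
  assumes inv: "invariant_measure I f p \<nu>" and g: "g \<in> borel_measurable borel"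
    and bound: "\<And>x. 0 \<le> g x" "\<And>x. g x \<le> K"
  shows "(\<integral>x. g x \<partial>\<nu>) = (\<Sum>i\<in>I. p i * (\<integral>x. g (f i x) \<partial>\<nu>))"
proof -
  interpret prob_space \<nu>
    using inv by (simp add: invariant_measure_def)
  have sets_nu [measurable_cong, simp]: "sets \<nu> = sets borel"
    using inv by (simp add: invariant_measure_def)
  have p: "\<And>i. i \<in> I \<Longrightarrow> p i > 0" and cont: "\<And>i. i \<in> I \<Longrightarrow> continuous_on UNIV (f i)"
    using inv by (auto simp: invariant_measure_def probabilistic_ifs_def ifs_def)
  note [measurable] = g
  have f [measurable]: "f i \<in> borel_measurable borel" if "i \<in> I" for i
    using cont[OF that] by (rule borel_measurable_continuous_onI)
  have int: "integrable \<nu> (\<lambda>x. g (h x))" if [measurable]: "h \<in> borel_measurable borel" for h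
    using bound by (intro integrable_const_bound[where B = K]) auto
  have nn: "(\<integral>\<^sup>+x. ennreal (g (h x)) \<partial>\<nu>) = ennreal (\<integral>x. g (h x) \<partial>\<nu>)"
    if "h \<in> borel_measurable borel" for h
    using int[OF that] bound by (intro nn_integral_eq_integral) auto
  have "ennreal (\<integral>x. g x \<partial>\<nu>) = (\<integral>\<^sup>+x. ennreal (g x) \<partial>\<nu>)"
    using nn[of "\<lambda>x. x"] by simp
  also have "\<dots> = (\<Sum>i\<in>I. ennreal (p i) * (\<integral>\<^sup>+x. ennreal (g (f i x)) \<partial>\<nu>))"
    by (rule nn_integral_invariant_measure[OF inv]) measurable
  also have "\<dots> = (\<Sum>i\<in>I. ennreal (p i * (\<integral>x. g (f i x) \<partial>\<nu>)))"
    using p bound by (intro sum.cong refl) (simp add: nn ennreal_mult less_imp_le)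
  also have "\<dots> = ennreal (\<Sum>i\<in>I. p i * (\<integral>x. g (f i x) \<partial>\<nu>))"
    using p bound by (intro sum_ennreal) (simp add: less_imp_le)
  finally show ?thesis
    using p bound by (subst (asm) ennreal_inj) (auto intro!: sum_nonneg simp: less_imp_le)
qed

text \<open>Open sets form an intersection-stable generator, and the indicator of an open set is a
  pointwise limit of Lipschitz functions with values in [0,1], built from the distance to the
  complement.\<close>

lemma measure_eqI_bounded_lipschitz:
  fixes M N :: "'a::metric_space measure"
  assumes "finite_measure M" "finite_measure N"
    and sets: "sets M = sets borel" "sets N = sets borel"
    and eq: "\<And>(g :: 'a \<Rightarrow> real) K. (\<And>x. 0 \<le> g x) \<Longrightarrow> (\<And>x. g x \<le> 1) \<Longrightarrow> K-lipschitz_on UNIV g \<Longrightarrow>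
      (\<integral>x. g x \<partial>M) = (\<integral>x. g x \<partial>N)"
  shows "M = N"
proof (rule measure_eqI_generator_eq[where E = "{S. open S}" and \<Omega> = UNIV and A = "\<lambda>_. UNIV"])
  interpret M: finite_measure M by fact
  interpret N: finite_measure N by fact
  note [measurable_cong] = sets
  show "Int_stable {S :: 'a set. open S}"
    by (auto simp: Int_stable_def)
  show "sets M = sigma_sets UNIV {S. open S}" "sets N = sigma_sets UNIV {S. open S}"
    by (simp_all add: sets borel_def)
  show "emeasure M UNIV \<noteq> \<infinity>"
    using M.emeasure_finite by auto
  fix S :: "'a set" assume "S \<in> {S. open S}"
  then have S [measurable]: "S \<in> sets borel" and "open S" by auto
  show "emeasure M S = emeasure N S"
  \<comment> \<open>The whole space is separate: its complement is empty, and \<open>infdist\<close>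
    to the empty set is 0 by convention, so the approximating functions would vanish.\<close>
  proof (cases "S = UNIV")
    case True
    have "(\<integral>x. 1 \<partial>M) = (\<integral>x. (1::real) \<partial>N)"
      by (rule eq[where K = 0]) (auto simp: lipschitz_on_def)
    moreover have "space M = UNIV" "space N = UNIV"
      using sets[THEN sets_eq_imp_space_eq] by auto
    ultimately show ?thesis
      by (simp add: True M.emeasure_eq_measure N.emeasure_eq_measure)
  next
    case False
    define g where "g n x = min 1 (real n * infdist x (- S))" for n x
    have lip: "(real n)-lipschitz_on UNIV (g n)" for n
    proof (rule lipschitz_onI)
      fix x y
      have "dist (g n x) (g n y) \<le> \<bar>real n * infdist x (- S) - real n * infdist y (- S)\<bar>"
        unfolding g_def dist_real_def by linarith
      also have "\<dots> = real n * \<bar>infdist x (- S) - infdist y (- S)\<bar>"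
        by (simp add: abs_mult flip: right_diff_distrib)
      also have "\<dots> \<le> real n * dist x y"
        by (intro mult_left_mono infdist_triangle_abs) auto
      finally show "dist (g n x) (g n y) \<le> real n * dist x y" .
    qed auto
    have bounds: "0 \<le> g n x" "g n x \<le> 1" for n x
      by (simp_all add: g_def infdist_nonneg)
    have meas [measurable]: "g n \<in> borel_measurable borel" for n
      using lipschitz_on_continuous_on[OF lip] by (rule borel_measurable_continuous_onI)
    have lim: "(\<lambda>n. g n x) \<longlonglongrightarrow> indicator S x" for x
    proof (cases "x \<in> S")
      case True
      then have pos: "infdist x (- S) > 0"
        using False \<open>open S\<close> by (intro infdist_pos_not_in_closed) auto
      then obtain m where m: "1 < real m * infdist x (- S)"
        using reals_Archimedean3 by blast
      have "g n x = 1" if "n \<ge> m" for n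
      proof -
        have "real m * infdist x (- S) \<le> real n * infdist x (- S)"
          using that pos by simp
        with m show ?thesis
          unfolding g_def by linarith
      qed
      then have "eventually (\<lambda>n. g n x = 1) sequentially"
        by (auto simp: eventually_sequentially)
      with True show ?thesis
        by (simp add: tendsto_eventually)
    next
      case False
      then show ?thesis by (simp add: g_def)
    qed
    have "(\<lambda>n. \<integral>x. g n x \<partial>M) \<longlonglongrightarrow> (\<integral>x. indicator S x \<partial>M)"
      using bounds lim
      by (intro integral_dominated_convergence[where w = "\<lambda>_. 1"]) auto
    moreover have "(\<lambda>n. \<integral>x. g n x \<partial>N) \<longlonglongrightarrow> (\<integral>x. indicator S x \<partial>N)"
      using bounds lim
      by (intro integral_dominated_convergence[where w = "\<lambda>_. 1"]) auto
    moreover have "(\<lambda>n. \<integral>x. g n x \<partial>M) = (\<lambda>n. \<integral>x. g n x \<partial>N)"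
      using eq bounds lip by blast
    ultimately have "(\<integral>x. indicator S x \<partial>M) = (\<integral>x. indicator S x \<partial>N :: real)"
      using LIMSEQ_unique by metis
    then have "measure M S = measure N S"
      using S by (simp add: sets)
    then show ?thesis
      by (simp add: M.emeasure_eq_measure N.emeasure_eq_measure)
  qed
qed auto

subsection \<open>Averaging over words\<close>

lemma perimeter_halves:
  fixes u w :: "'a::real_normed_vector"
  shows "norm ((1/4) *\<^sub>R (u + w)) + norm ((1/8) *\<^sub>R (3 *\<^sub>R w - u)) + norm ((1/8) *\<^sub>R (3 *\<^sub>R u - w))
    \<le> (norm u + norm w + norm (u - w)) / 2"
proof -
  \<comment> \<open>The three vectors on the left are the sides of the image triangle after
    composing with \<open>tri_map 2\<close> three times. Writing
    \<open>3w - u = 2w + (w - u)\<close> and \<open>3u - w = 2u + (u - w)\<close> bounds their total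
    length by \<open>(norm u + norm w) / 2 + norm (u - w) / 4\<close>.\<close>
  have "norm (3 *\<^sub>R w - u) \<le> 2 * norm w + norm (u - w)"
    using norm_triangle_ineq[of "2 *\<^sub>R w" "w - u"]
    by (simp add: norm_minus_commute algebra_simps scaleR_left_distrib[of 2 1, simplified])
  moreover have "norm (3 *\<^sub>R u - w) \<le> 2 * norm u + norm (u - w)"
    using norm_triangle_ineq[of "2 *\<^sub>R u" "u - w"]
    by (simp add: algebra_simps scaleR_left_distrib[of 2 1, simplified])
  ultimately show ?thesis
    using norm_triangle_ineq[of u w] norm_ge_zero[of "u - w"] by (simp del: norm_ge_zero)
qed

text \<open>The left side is the length of a median; the path along the side \<open>w\<close> and
  half of the opposite side is at least as long.\<close>

lemma norm_midpoint_le: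
  fixes u w :: "'a::real_normed_vector"
  shows "norm (u + w) / 2 \<le> norm w + norm (u - w) / 2"
proof -
  have "u + w = 2 *\<^sub>R w + (u - w)"
    by (simp add: scaleR_2)
  then have "norm (u + w) \<le> norm (2 *\<^sub>R w) + norm (u - w)"
    by (metis norm_triangle_ineq)
  then show ?thesis by simp
qed

text \<open>These are the affine maps of the plane, given by the image \<open>a\<close> of the
  origin and the side vectors \<open>u\<close>, \<open>w\<close> of the image triangle at
  \<open>a\<close>. Composition with a \<open>tri_map\<close> becomes a substitution in
  \<open>a\<close>, \<open>u\<close>, \<open>w\<close>.\<close>

definition coord_affine :: "(real^2 \<Rightarrow> real^2) \<Rightarrow> bool" where
  "coord_affine \<phi> \<longleftrightarrow> (\<exists>a u w. \<phi> = (\<lambda>v. a + (v $ 1) *\<^sub>R u + (v $ 2) *\<^sub>R w))"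

definition image_perimeter :: "(real^2 \<Rightarrow> real^2) \<Rightarrow> real" where
  "image_perimeter \<phi> = norm (\<phi> (vector [1, 0]) - \<phi> 0) + norm (\<phi> (vector [0, 1]) - \<phi> 0) +
     norm (\<phi> (vector [1, 0]) - \<phi> (vector [0, 1]))"

lemma coord_affine_id: "coord_affine id"
  unfolding coord_affine_def
  by (intro exI[of _ 0] exI[of _ "vector [1, 0]"] exI[of _ "vector [0, 1]"])
    (auto simp: fun_eq_iff vec_eq_iff forall_2)

text \<open>Composition is on the right because \<open>address_comp\<close> puts each new letter
  innermost.\<close>

lemma comp_tri_map:
  fixes a u w :: "real^2"
  defines "\<phi> \<equiv> \<lambda>v. a + (v $ 1) *\<^sub>R u + (v $ 2) *\<^sub>R w"
  shows "\<phi> \<circ> tri_map 1 = (\<lambda>v. a + (v $ 1) *\<^sub>R u + (v $ 2) *\<^sub>R ((1/2) *\<^sub>R (u + w)))"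
    and "\<phi> \<circ> tri_map 2 = (\<lambda>v. (a + w) + (v $ 1) *\<^sub>R (- w) + (v $ 2) *\<^sub>R ((1/2) *\<^sub>R (u - w)))"
  unfolding \<phi>_def by (auto simp: fun_eq_iff tri_map_1 tri_map_2 algebra_simps)

lemma coord_affine_comp_tri_map:
  assumes "coord_affine \<phi>" "i \<in> {1, 2}"
  shows "coord_affine (\<phi> \<circ> tri_map i)"
proof -
  obtain a u w where \<phi>: "\<phi> = (\<lambda>v. a + (v $ 1) *\<^sub>R u + (v $ 2) *\<^sub>R w)"
    using assms(1) by (auto simp: coord_affine_def)
  consider "i = 1" | "i = 2"
    using assms(2) by blast
  then show ?thesis
  proof cases
    assume "i = 1"
    then show ?thesis
      unfolding \<phi> by (simp only: comp_tri_map coord_affine_def) blast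
  next
    assume "i = 2"
    then show ?thesis
      unfolding \<phi> by (simp only: comp_tri_map coord_affine_def) blast
  qed
qed

lemma image_perimeter_eq:
  "image_perimeter (\<lambda>v. a + (v $ 1) *\<^sub>R u + (v $ 2) *\<^sub>R w) = norm u + norm w + norm (u - w)"
  by (simp add: image_perimeter_def)

lemma image_perimeter_nonneg: "0 \<le> image_perimeter \<phi>"
  by (simp add: image_perimeter_def)

text \<open>The new image is one half of the old one, cut along a median. It keeps one of the sides
  \<open>u\<close>, \<open>w\<close>, has half of the side \<open>u - w\<close>, and has the median
  in place of the other side.\<close>

lemma image_perimeter_comp_tri_map_le:
  assumes "coord_affine \<phi>" "i \<in> {1, 2}"
  shows "image_perimeter (\<phi> \<circ> tri_map i) \<le> image_perimeter \<phi>"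
proof -
  obtain a u w where \<phi>: "\<phi> = (\<lambda>v. a + (v $ 1) *\<^sub>R u + (v $ 2) *\<^sub>R w)"
    using assms(1) by (auto simp: coord_affine_def)
  consider "i = 1" | "i = 2"
    using assms(2) by blast
  then show ?thesis
  proof cases
    assume i: "i = 1"
    have "u - (1/2) *\<^sub>R (u + w) = (1/2) *\<^sub>R (u - w)"
      by (simp add: vec_eq_iff forall_2 field_simps)
    then show ?thesis
      unfolding \<phi> i comp_tri_map image_perimeter_eq using norm_midpoint_le[of u w] by simp
  next
    assume i: "i = 2"
    have "- w - (1/2) *\<^sub>R (u - w) = - ((1/2) *\<^sub>R (u + w))"
      by (simp add: vec_eq_iff forall_2 field_simps)
    then have "norm (- w - (1/2) *\<^sub>R (u - w)) = norm (u + w) / 2"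
      by simp
    then show ?thesis
      unfolding \<phi> i comp_tri_map image_perimeter_eq using norm_midpoint_le[of w u]
      by (simp add: norm_minus_commute add.commute)
  qed
qed

lemma image_perimeter_comp_222_le:
  assumes "coord_affine \<phi>"
  shows "image_perimeter (\<phi> \<circ> tri_map 2 \<circ> tri_map 2 \<circ> tri_map 2) \<le> image_perimeter \<phi> / 2"
proof -
  obtain a u w where \<phi>: "\<phi> = (\<lambda>v. a + (v $ 1) *\<^sub>R u + (v $ 2) *\<^sub>R w)"
    using assms(1) by (auto simp: coord_affine_def)
  \<comment> \<open>Side vectors obtained from three rounds of the substitution
    \<open>u := - w\<close>, \<open>w := (u - w) / 2\<close> for \<open>tri_map 2\<close>.\<close>
  let ?u = "- ((1/2) *\<^sub>R (- w - (1/2) *\<^sub>R (u - w)))"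
  let ?w = "(1/2) *\<^sub>R (- ((1/2) *\<^sub>R (u - w)) - (1/2) *\<^sub>R (- w - (1/2) *\<^sub>R (u - w)))"
  have "?u = (1/4) *\<^sub>R (u + w)" "?w = (1/8) *\<^sub>R (3 *\<^sub>R w - u)" "?u - ?w = (1/8) *\<^sub>R (3 *\<^sub>R u - w)"
    by (simp_all add: vec_eq_iff forall_2 field_simps)
  then show ?thesis
    unfolding \<phi> comp_tri_map image_perimeter_eq using perimeter_halves[of u w] by presburger
qed

text \<open>The perimeter serves as a Lipschitz constant: each coordinate of \<open>x - y\<close> is
  at most its norm, and \<open>norm u + norm w\<close> is at most the perimeter.\<close>

lemma dist_coord_affine_le:
  assumes "coord_affine \<phi>"
  shows "dist (\<phi> x) (\<phi> y) \<le> dist x y * image_perimeter \<phi>"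
proof -
  obtain a u w where \<phi>: "\<phi> = (\<lambda>v. a + (v $ 1) *\<^sub>R u + (v $ 2) *\<^sub>R w)"
    using assms(1) by (auto simp: coord_affine_def)
  have "\<phi> x - \<phi> y = ((x - y) $ 1) *\<^sub>R u + ((x - y) $ 2) *\<^sub>R w"
    by (simp add: \<phi> algebra_simps)
  also have "norm \<dots> \<le> \<bar>(x - y) $ 1\<bar> * norm u + \<bar>(x - y) $ 2\<bar> * norm w"
    by (metis norm_scaleR norm_triangle_ineq)
  also have "\<dots> \<le> norm (x - y) * norm u + norm (x - y) * norm w"
    by (intro add_mono mult_right_mono component_le_norm_cart) auto
  also have "\<dots> \<le> norm (x - y) * image_perimeter \<phi>"
    unfolding \<phi> image_perimeter_eq by (simp add: algebra_simps)
  finally show ?thesis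
    by (simp add: dist_norm)
qed

text \<open>The average of \<open>\<Phi> (\<phi> \<circ> f\<^sub>w)\<close> over the \<open>2\<^sup>n\<close> words \<open>w\<close> of length \<open>n\<close>.\<close>

primrec word_mean :: "nat \<Rightarrow> ((real^2 \<Rightarrow> real^2) \<Rightarrow> real) \<Rightarrow> (real^2 \<Rightarrow> real^2) \<Rightarrow> real" where
  "word_mean 0 \<Phi> \<phi> = \<Phi> \<phi>"
| "word_mean (Suc n) \<Phi> \<phi> =
     (word_mean n \<Phi> (\<phi> \<circ> tri_map 1) + word_mean n \<Phi> (\<phi> \<circ> tri_map 2)) / 2"

lemma word_mean_diff: "word_mean n (\<lambda>\<psi>. \<Phi> \<psi> - \<Psi> \<psi>) \<phi> = word_mean n \<Phi> \<phi> - word_mean n \<Psi> \<phi>"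
  by (induction n arbitrary: \<phi>) (simp_all add: add_divide_distrib diff_divide_distrib)

lemma word_mean_cmult: "word_mean n (\<lambda>\<psi>. c * \<Phi> \<psi>) \<phi> = c * word_mean n \<Phi> \<phi>"
  by (induction n arbitrary: \<phi>) (simp_all add: distrib_left)

lemma word_mean_const [simp]: "word_mean n (\<lambda>\<psi>. c) \<phi> = c"
  by (induction n arbitrary: \<phi>) simp_all

text \<open>Comparing the functionals on affine maps suffices, since the recursion visits only
  affine maps.\<close>

lemma word_mean_mono:
  assumes "coord_affine \<phi>" and "\<And>\<psi>. coord_affine \<psi> \<Longrightarrow> \<Phi> \<psi> \<le> \<Psi> \<psi>"
  shows "word_mean n \<Phi> \<phi> \<le> word_mean n \<Psi> \<phi>"
  using assms(1)
proof (induction n arbitrary: \<phi>)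
  case 0
  then show ?case using assms(2) by simp
next
  case (Suc n)
  have "word_mean n \<Phi> (\<phi> \<circ> tri_map i) \<le> word_mean n \<Psi> (\<phi> \<circ> tri_map i)" if "i \<in> {1, 2}" for i
    using that Suc coord_affine_comp_tri_map by blast
  from this[of 1] this[of 2] show ?case
    by simp
qed

text \<open>A positive average has a positive term; this turns estimates on averages into a concrete
  word.\<close>

lemma word_mean_pos_imp_ex_address:
  assumes "word_mean n \<Phi> \<phi> > 0"
  shows "\<exists>s. (\<forall>k. s k \<in> {1, 2}) \<and> \<Phi> (\<phi> \<circ> address_comp tri_map s n) > 0"
  using assms
proof (induction n arbitrary: \<phi>)
  case 0
  then show ?case by (intro exI[of _ "\<lambda>_. 1"]) auto
next
  case (Suc n)
  then have "word_mean n \<Phi> (\<phi> \<circ> tri_map 1) > 0 \<or> word_mean n \<Phi> (\<phi> \<circ> tri_map 2) > 0"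
    by auto
  then obtain i where i: "i \<in> {1, 2}" "word_mean n \<Phi> (\<phi> \<circ> tri_map i) > 0"
    by blast
  from Suc.IH[OF i(2)] obtain s where
    s: "\<forall>k. s k \<in> {1, 2}" "\<Phi> (\<phi> \<circ> tri_map i \<circ> address_comp tri_map s n) > 0"
    by blast
  \<comment> \<open>Prepends the letter \<open>i\<close>. Addresses start at index 1, so
    \<open>s\<close> moves up by one; \<open>t 0\<close> equals \<open>s 0\<close> by truncated
    subtraction and is still a legal letter.\<close>
  define t where "t k = (if k = 1 then i else s (k - 1))" for k
  have "address_comp tri_map t (Suc m) = tri_map i \<circ> address_comp tri_map s m" for m
    by (induction m) (auto simp: t_def fun_eq_iff)
  moreover have "\<forall>k. t k \<in> {1, 2}"
    using i s by (auto simp: t_def)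
  ultimately show ?case
    using s(2) by (metis comp_assoc)
qed

lemma word_mean_image_perimeter_le:
  assumes "coord_affine \<phi>"
  shows "word_mean n image_perimeter \<phi> \<le> image_perimeter \<phi>"
  using assms
proof (induction n arbitrary: \<phi>)
  case (Suc n)
  have "word_mean n image_perimeter (\<phi> \<circ> tri_map i) \<le> image_perimeter \<phi>" if "i \<in> {1, 2}" for i
    using Suc.IH[OF coord_affine_comp_tri_map[OF Suc.prems that]]
      image_perimeter_comp_tri_map_le[OF Suc.prems that] by linarith
  from this[of 1] this[of 2] show ?case
    by simp
qed simp

text \<open>Of the eight words of length three, \<open>222\<close> halves the perimeter and the others do not increase
  it, whence the factor \<open>7/8 + 1/16 = 15/16\<close>.\<close>

lemma word_mean_image_perimeter_decay:
  assumes "coord_affine \<phi>"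
  shows "word_mean n image_perimeter \<phi> \<le> (15/16) ^ (n div 3) * image_perimeter \<phi>"
  using assms
proof (induction n arbitrary: \<phi> rule: less_induct)
  case (less n)
  note affine = coord_affine_comp_tri_map and le = image_perimeter_comp_tri_map_le
  show ?case
  proof (cases "n < 3")
    case True
    then show ?thesis using word_mean_image_perimeter_le[OF less.prems] by simp
  next
    case False
    then obtain m where "n = 3 + m"
      using le_Suc_ex not_less by blast
    then have n: "n = Suc (Suc (Suc m))"
      by simp
    let ?c = "(15/16 :: real) ^ (m div 3)"
    let ?\<phi> = "\<lambda>i j k. \<phi> \<circ> tri_map i \<circ> tri_map j \<circ> tri_map k"
    have IH: "word_mean m image_perimeter (?\<phi> i j k) \<le> ?c * image_perimeter (?\<phi> i j k)"
      if "i \<in> {1, 2}" "j \<in> {1, 2}" "k \<in> {1, 2}" for i j k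
      using that less.prems n by (intro less.IH affine) auto
    have "image_perimeter (?\<phi> i j k) \<le> image_perimeter \<phi>"
      if "i \<in> {1, 2}" "j \<in> {1, 2}" "k \<in> {1, 2}" for i j k
      using le[OF less.prems that(1)] le[OF affine[OF less.prems that(1)] that(2)]
        le[OF affine[OF affine[OF less.prems that(1)] that(2)] that(3)] by linarith
    then have *: "word_mean m image_perimeter (?\<phi> i j k) \<le> ?c * image_perimeter \<phi>"
      if "i \<in> {1, 2}" "j \<in> {1, 2}" "k \<in> {1, 2}" for i j k
      using IH[OF that] that by (meson mult_left_mono order_trans zero_le_power zero_le_divide_iff zero_le_numeral)
    have "word_mean m image_perimeter (?\<phi> 2 2 2) \<le> ?c * (image_perimeter \<phi> / 2)"
      by (rule order_trans[OF IH mult_left_mono[OF image_perimeter_comp_222_le[OF less.prems]]]) auto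
    then have "word_mean n image_perimeter \<phi> \<le> (15/16) * (?c * image_perimeter \<phi>)"
      using *[of 1 1 1] *[of 1 1 2] *[of 1 2 1] *[of 1 2 2] *[of 2 1 1] *[of 2 1 2] *[of 2 2 1]
      by (simp add: n add_divide_distrib)
    also have "\<dots> = (15/16) ^ (n div 3) * image_perimeter \<phi>"
    proof -
      have "n div 3 = Suc (m div 3)"
        by (simp add: n)
      then show ?thesis by simp
    qed
    finally show ?thesis .
  qed
qed

lemma word_mean_image_perimeter_tendsto_0:
  assumes "coord_affine \<phi>"
  shows "(\<lambda>n. word_mean n image_perimeter \<phi>) \<longlonglongrightarrow> 0"
proof (rule tendsto_sandwich)
  show "\<forall>\<^sub>F n in sequentially. 0 \<le> word_mean n image_perimeter \<phi>"
    using word_mean_mono[OF assms, where \<Phi> = "\<lambda>_. 0" and \<Psi> = image_perimeter]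
    by (simp add: image_perimeter_nonneg)
  show "\<forall>\<^sub>F n in sequentially. word_mean n image_perimeter \<phi> \<le> (15/16) ^ (n div 3) * image_perimeter \<phi>"
    using word_mean_image_perimeter_decay[OF assms] by simp
  have "filterlim (\<lambda>n::nat. n div 3) at_top sequentially"
    unfolding filterlim_at_top
    by (metis (mono_tags, lifting) eventually_sequentiallyI div_le_mono nonzero_mult_div_cancel_right zero_neq_numeral)
  then have "(\<lambda>n. (15/16 :: real) ^ (n div 3)) \<longlonglongrightarrow> 0"
    by (rule filterlim_compose[OF LIMSEQ_power_zero, rotated]) simp
  then show "(\<lambda>n. (15/16) ^ (n div 3) * image_perimeter \<phi>) \<longlonglongrightarrow> 0"
    by (rule tendsto_mult_left_zero)
qed simp

text \<open>The same word is applied to both points, so each term differs by at most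
  \<open>K\<close> times the distance times the perimeter of that word's map.\<close>

lemma word_mean_eval_dist_le:
  assumes "coord_affine \<phi>" and "K-lipschitz_on UNIV (g :: real^2 \<Rightarrow> real)"
  shows "\<bar>word_mean n (\<lambda>\<psi>. g (\<psi> x)) \<phi> - word_mean n (\<lambda>\<psi>. g (\<psi> y)) \<phi>\<bar>
    \<le> K * dist x y * word_mean n image_perimeter \<phi>"
proof -
  have K: "K \<ge> 0"
    using assms(2) by (rule lipschitz_on_nonneg)
  \<comment> \<open>The one-sided bound for all \<open>x\<close>, \<open>y\<close> gives the
    absolute value by exchanging them.\<close>
  have "word_mean n (\<lambda>\<psi>. g (\<psi> x)) \<phi> - word_mean n (\<lambda>\<psi>. g (\<psi> y)) \<phi>
      \<le> K * dist x y * word_mean n image_perimeter \<phi>" for x y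
  proof -
    have "g (\<psi> x) - g (\<psi> y) \<le> K * dist x y * image_perimeter \<psi>" if "coord_affine \<psi>" for \<psi>
    proof -
      have "g (\<psi> x) - g (\<psi> y) \<le> K * dist (\<psi> x) (\<psi> y)"
        using lipschitz_onD[OF assms(2), of "\<psi> x" "\<psi> y"] by (simp add: dist_real_def)
      also have "\<dots> \<le> K * (dist x y * image_perimeter \<psi>)"
        using K that by (intro mult_left_mono dist_coord_affine_le)
      finally show ?thesis by simp
    qed
    then show ?thesis
      using word_mean_mono[OF assms(1), where \<Phi> = "\<lambda>\<psi>. g (\<psi> x) - g (\<psi> y)" and n = n
          and \<Psi> = "\<lambda>\<psi>. K * dist x y * image_perimeter \<psi>"]
      by (simp add: word_mean_diff word_mean_cmult)
  qed
  from this[of x y] this[of y x] show ?thesis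
    by (simp add: dist_commute)
qed

section \<open>Integrals of word averages and uniqueness of the invariant measure\<close>

lemma integral_word_mean:
  assumes inv: "invariant_measure {1, 2} tri_map (\<lambda>_. 1/2) \<nu>"
    and g [measurable]: "g \<in> borel_measurable borel"
    and bounds: "\<And>x. 0 \<le> g x" "\<And>x. g x \<le> 1"
    and "\<phi> \<in> borel_measurable borel"
  shows "integrable \<nu> (\<lambda>x. word_mean n (\<lambda>\<psi>. g (\<psi> x)) \<phi>) \<and>
    (\<integral>x. word_mean n (\<lambda>\<psi>. g (\<psi> x)) \<phi> \<partial>\<nu>) = (\<integral>x. g (\<phi> x) \<partial>\<nu>)"
  \<comment> \<open>The map \<open>\<phi>\<close> is generalized because the recursion replaces it
    by \<open>\<phi> \<circ> tri_map i\<close>. Integrability is carried along so that the integral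
    of the average splits.\<close>
  using assms(5)
proof (induction n arbitrary: \<phi>)
  interpret prob_space \<nu>
    using inv by (simp add: invariant_measure_def)
  have [measurable_cong]: "sets \<nu> = sets borel"
    using inv by (simp add: invariant_measure_def)
  {
    case 0
    note [measurable] = this
    show ?case
      using bounds by (auto intro!: integrable_const_bound[where B = 1])
  next
    case (Suc n)
    note [measurable] = Suc.prems
    have meas: "\<phi> \<circ> tri_map i \<in> borel_measurable borel" for i
      by measurable
    have "(\<integral>x. g (\<phi> x) \<partial>\<nu>) = (\<Sum>i\<in>{1, 2}. 1/2 * (\<integral>x. g (\<phi> (tri_map i x)) \<partial>\<nu>))"
      using bounds by (intro integral_invariant_measure[OF inv, where K = 1]) auto
    then show ?case
      using Suc.IH[OF meas[of 1]] Suc.IH[OF meas[of 2]] by (simp add: o_def)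
  }
qed

text \<open>The sequence on the left does not depend on \<open>\<nu>\<close>, which is what yields
  uniqueness. Averages started at \<open>x\<close> and at 0 become equal in the limit, and
  integrating the former over \<open>\<nu>\<close> always gives the integral of
  \<open>g\<close>.\<close>

lemma word_mean_tendsto_integral:
  assumes inv: "invariant_measure {1, 2} tri_map (\<lambda>_. 1/2) \<nu>"
    and lip: "K-lipschitz_on UNIV g" and bounds: "\<And>x. 0 \<le> g x" "\<And>x. g x \<le> 1"
  shows "(\<lambda>n. word_mean n (\<lambda>\<psi>. g (\<psi> 0)) id) \<longlonglongrightarrow> (\<integral>x. g x \<partial>\<nu>)"
proof -
  interpret prob_space \<nu>
    using inv by (simp add: invariant_measure_def)
  have [measurable]: "g \<in> borel_measurable borel"
    using lipschitz_on_continuous_on[OF lip] by (rule borel_measurable_continuous_onI)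
  let ?P = "\<lambda>n x. word_mean n (\<lambda>\<psi>. g (\<psi> x)) id"
  have int: "integrable \<nu> (?P n)" "(\<integral>x. ?P n x \<partial>\<nu>) = (\<integral>x. g x \<partial>\<nu>)" for n
    using integral_word_mean[where g = g and \<nu> = \<nu> and \<phi> = id and n = n] inv bounds by auto
  have P_bounds: "0 \<le> ?P n x" "?P n x \<le> 1" for n x
    using word_mean_mono[OF coord_affine_id, where \<Phi> = "\<lambda>_. 0" and \<Psi> = "\<lambda>\<psi>. g (\<psi> x)" and n = n]
      word_mean_mono[OF coord_affine_id, where \<Phi> = "\<lambda>\<psi>. g (\<psi> x)" and \<Psi> = "\<lambda>_. 1" and n = n]
      bounds by auto
  have "(\<lambda>n. \<integral>x. ?P n 0 - ?P n x \<partial>\<nu>) \<longlonglongrightarrow> (\<integral>x. 0 \<partial>\<nu>)"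
  proof (rule integral_dominated_convergence[where w = "\<lambda>_. 1"])
    show "(\<lambda>x. ?P n 0 - ?P n x) \<in> borel_measurable \<nu>" for n
      using int(1)[of n] by measurable
    have "(\<lambda>n. ?P n 0 - ?P n x) \<longlonglongrightarrow> 0" for x
    proof (rule Lim_null_comparison)
      show "\<forall>\<^sub>F n in sequentially. norm (?P n 0 - ?P n x)
          \<le> K * dist 0 x * word_mean n image_perimeter id"
        unfolding real_norm_def
        by (intro always_eventually allI word_mean_eval_dist_le coord_affine_id lip)
      show "(\<lambda>n. K * dist 0 x * word_mean n image_perimeter id) \<longlonglongrightarrow> 0"
        by (intro tendsto_mult_right_zero word_mean_image_perimeter_tendsto_0 coord_affine_id)
    qed
    then show "AE x in \<nu>. (\<lambda>n. ?P n 0 - ?P n x) \<longlonglongrightarrow> 0"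
      by (intro AE_I2)
    have "norm (?P n 0 - ?P n x) \<le> 1" for n x
      using P_bounds[of n 0] P_bounds[of n x] unfolding real_norm_def by linarith
    then show "AE x in \<nu>. norm (?P n 0 - ?P n x) \<le> 1" for n
      by (intro AE_I2)
  qed auto
  \<comment> \<open>Total mass 1 makes the integral of the constant \<open>?P n 0\<close> equal to
    that constant.\<close>
  then have "(\<lambda>n. ?P n 0 - (\<integral>x. g x \<partial>\<nu>)) \<longlonglongrightarrow> 0"
    using int by (simp add: prob_space)
  then show ?thesis
    by (simp add: LIM_zero_iff)
qed

lemma invariant_measure_unique:
  assumes "invariant_measure {1, 2} tri_map (\<lambda>_. 1/2) \<mu>"
    and "invariant_measure {1, 2} tri_map (\<lambda>_. 1/2) \<nu>"
  shows "\<mu> = \<nu>"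
proof (rule measure_eqI_bounded_lipschitz)
  show "finite_measure \<mu>" "finite_measure \<nu>" "sets \<mu> = sets borel" "sets \<nu> = sets borel"
    using assms by (auto simp: invariant_measure_def prob_space_def)
  fix g :: "real^2 \<Rightarrow> real" and K
  assume "\<And>x. 0 \<le> g x" "\<And>x. g x \<le> 1" "K-lipschitz_on UNIV g"
  then show "(\<integral>x. g x \<partial>\<mu>) = (\<integral>x. g x \<partial>\<nu>)"
    using assms by (intro LIMSEQ_unique[OF word_mean_tendsto_integral word_mean_tendsto_integral])
qed

text \<open>All large \<open>n\<close> are covered because a lower Kuratowski limit involves every
  late iterate; the radius \<open>R\<close> is arbitrary because starting points are.\<close>

lemma ex_address_into_ball:
  assumes a: "a \<in> tri_filled" and "r > 0" "R \<ge> 0"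
  shows "\<forall>\<^sub>F n in sequentially. \<exists>s. (\<forall>k. s k \<in> {1, 2}) \<and>
    address_comp tri_map s n ` cball 0 R \<subseteq> ball a r"
proof -
  \<comment> \<open>A 1-Lipschitz bump with values in [0,1] that is positive exactly on
    \<open>ball a r\<close>.\<close>
  define g where "g x = min 1 (max 0 (r - dist x a))" for x
  have lip: "1-lipschitz_on UNIV g"
  proof (rule lipschitz_onI)
    fix x y
    have "dist (g x) (g y) \<le> \<bar>dist x a - dist y a\<bar>"
      unfolding g_def dist_real_def by linarith
    also have "\<dots> \<le> dist x y"
      by (metis abs_dist_diff_le dist_commute)
    finally show "dist (g x) (g y) \<le> 1 * dist x y" by simp
  qed auto
  have bounds: "0 \<le> g x" "g x \<le> 1" for x
    by (simp_all add: g_def)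
  interpret prob_space tri_measure
    by (rule prob_space_tri_measure)
  have [measurable_cong]: "sets tri_measure = sets borel"
    by (rule sets_tri_measure)
  have meas [measurable]: "g \<in> borel_measurable borel"
    using lipschitz_on_continuous_on[OF lip] by (rule borel_measurable_continuous_onI)
  have int: "integrable tri_measure g"
    using bounds by (intro integrable_const_bound[where B = 1]) auto
  have "(\<integral>x. g x \<partial>tri_measure) \<noteq> 0"
  proof
    assume "(\<integral>x. g x \<partial>tri_measure) = 0"
    then have "AE x in tri_measure. g x = 0"
      using integral_nonneg_eq_0_iff_AE[OF int] bounds by simp
    then have "AE x in tri_measure. x \<notin> ball a r"
      by eventually_elim (auto simp: g_def dist_commute split: if_splits)
    then have "emeasure tri_measure (ball a r) = 0"
      by (subst (asm) AE_iff_measurable[OF _ refl])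
        (auto simp: sets_eq_imp_space_eq[OF sets_tri_measure] simp del: mem_ball)
    moreover have "emeasure tri_measure (ball a r) > 0"
      using a \<open>r > 0\<close> centre_in_ball[of a r] by (intro emeasure_tri_measure_pos) blast+
    ultimately show False by simp
  qed
  then have pos: "(\<integral>x. g x \<partial>tri_measure) > 0"
    using bounds by (simp add: less_le)
  \<comment> \<open>If \<open>\<Phi> \<psi> > 0\<close>, then \<open>\<psi> 0\<close> lies so deep inside the ball, relative to the expansion of \<open>\<psi>\<close>, that
    \<open>\<psi>\<close> maps all of \<open>cball 0 R\<close> into the ball.\<close>
  define \<Phi> where "\<Phi> \<psi> = g (\<psi> 0) - R * image_perimeter \<psi>" for \<psi>
  have "(\<lambda>n. word_mean n \<Phi> id) \<longlonglongrightarrow> (\<integral>x. g x \<partial>tri_measure) - R * 0"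
    unfolding \<Phi>_def word_mean_diff word_mean_cmult
    by (intro tendsto_intros word_mean_tendsto_integral[OF invariant_tri_measure lip] bounds
        word_mean_image_perimeter_tendsto_0 coord_affine_id)
  then have "\<forall>\<^sub>F n in sequentially. word_mean n \<Phi> id > 0"
    using pos by (simp add: order_tendsto_iff)
  then show ?thesis
  proof eventually_elim
    case (elim n)
    then obtain s where s: "\<forall>k. s k \<in> {1, 2}" and "\<Phi> (address_comp tri_map s n) > 0"
      using word_mean_pos_imp_ex_address[of n \<Phi> id] by auto
    moreover define \<psi> where "\<psi> = address_comp tri_map s n"
    ultimately have \<Phi>: "g (\<psi> 0) > R * image_perimeter \<psi>"
      by (simp add: \<Phi>_def)
    have "coord_affine (address_comp tri_map s m)" for m
    proof (induction m)
      case 0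
      show ?case
        unfolding address_comp.simps by (rule coord_affine_id)
    next
      case (Suc m)
      then show ?case
        unfolding address_comp.simps using s by (intro coord_affine_comp_tri_map) auto
    qed
    then have "coord_affine \<psi>"
      by (simp add: \<psi>_def)
    have "\<psi> x \<in> ball a r" if "x \<in> cball 0 R" for x
    proof -
      have "g (\<psi> 0) - g (\<psi> x) \<le> dist (\<psi> 0) (\<psi> x)"
        using lipschitz_onD[OF lip, of "\<psi> 0" "\<psi> x"] by (simp add: dist_real_def)
      also have "\<dots> \<le> dist 0 x * image_perimeter \<psi>"
        by (rule dist_coord_affine_le) fact
      also have "\<dots> \<le> R * image_perimeter \<psi>"
        using that by (intro mult_right_mono image_perimeter_nonneg) simp
      finally have "g (\<psi> x) > 0"
        using \<Phi> by linarith
      then show ?thesis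
        by (simp add: g_def dist_commute split: if_splits)
    qed
    with s show ?case
      unfolding \<psi>_def by blast
  qed
qed

subsection \<open>Semiattractor and fibres\<close>

text \<open>Nearly closest points to \<open>y\<close> in the sets \<open>S n\<close> form the
  sequence. Every \<open>S n\<close> must be nonempty, since the ball condition provides points only
  for late \<open>n\<close>.\<close>

lemma mem_lower_kuratowski_limitI:
  fixes y :: "'a::metric_space"
  assumes ne: "\<And>n. S n \<noteq> {}" and ev: "\<And>r. r > 0 \<Longrightarrow> \<forall>\<^sub>F n in sequentially. S n \<inter> ball y r \<noteq> {}"
  shows "y \<in> lower_kuratowski_limit S"
proof -
  \<comment> \<open>The slack \<open>1 / real (Suc n)\<close> is there because the infimal distance
    need not be attained.\<close>
  have "\<exists>x. x \<in> S n \<and> dist y x < infdist y (S n) + 1 / real (Suc n)" for n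
  proof (rule ccontr)
    assume "\<not> ?thesis"
    then have "infdist y (S n) + 1 / real (Suc n) \<le> infdist y (S n)"
      unfolding infdist_notempty[OF ne] by (intro cINF_greatest ne) force
    then show False by simp
  qed
  then obtain x where x: "\<And>n. x n \<in> S n" "\<And>n. dist y (x n) < infdist y (S n) + 1 / real (Suc n)"
    by metis
  have "(\<lambda>n. infdist y (S n)) \<longlonglongrightarrow> 0"
  proof (rule order_tendstoI)
    fix r :: real assume "0 < r"
    from ev[OF this] show "\<forall>\<^sub>F n in sequentially. infdist y (S n) < r"
      by eventually_elim (auto intro: le_less_trans[OF infdist_le])
  qed (auto intro!: always_eventually less_le_trans[OF _ infdist_nonneg])
  moreover have "(\<lambda>n. 1 / real (Suc n)) \<longlonglongrightarrow> 0"
    using LIMSEQ_inverse_real_of_nat by (simp add: inverse_eq_divide)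
  ultimately have "(\<lambda>n. infdist y (S n) + 1 / real (Suc n)) \<longlonglongrightarrow> 0 + 0"
    by (rule tendsto_add)
  then have lim: "(\<lambda>n. infdist y (S n) + 1 / real (Suc n)) \<longlonglongrightarrow> 0"
    by simp
  have "norm (dist (x n) y) \<le> infdist y (S n) + 1 / real (Suc n)" for n
    using x(2)[of n] by (simp add: dist_commute)
  then have "\<forall>\<^sub>F n in sequentially. norm (dist (x n) y) \<le> infdist y (S n) + 1 / real (Suc n)"
    by (intro always_eventually allI)
  then have "(\<lambda>n. dist (x n) y) \<longlonglongrightarrow> 0"
    using lim by (rule Lim_null_comparison)
  then have "x \<longlonglongrightarrow> y"
    by (rule iffD2[OF tendsto_dist_iff])
  with x(1) show ?thesis
    unfolding lower_kuratowski_limit_def by blast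
qed

text \<open>\<open>address_comp\<close> grows at the inner end, whereas iterates of the Hutchinson
  operator grow at the outer end; this links the two.\<close>

lemma address_comp_Suc_left:
  "address_comp f s (Suc n) = f (s 1) \<circ> address_comp f (\<lambda>k. s (Suc k)) n"
  by (induction n) (auto simp: fun_eq_iff One_nat_def)

lemma address_comp_in_hutchinson_pow:
  assumes "\<And>k. s k \<in> I" "x \<in> S"
  shows "address_comp f s n x \<in> (hutchinson I f ^^ n) S"
  using assms(1)
proof (induction n arbitrary: s)
  case 0
  then show ?case using assms(2) by simp
next
  case (Suc n)
  have "address_comp f (\<lambda>k. s (Suc k)) n x \<in> (hutchinson I f ^^ n) S"
    by (intro Suc.IH Suc.prems)
  then have "f (s 1) (address_comp f (\<lambda>k. s (Suc k)) n x) \<in> (\<Union>i\<in>I. f i ` (hutchinson I f ^^ n) S)"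
    by (intro UN_I[OF Suc.prems[of 1]] imageI)
  then show ?case
    unfolding address_comp_Suc_left funpow.simps comp_apply hutchinson_def
    by (rule subsetD[OF closure_subset])
qed

lemma mono_hutchinson: "mono (hutchinson I f)"
  unfolding hutchinson_def by (intro monoI closure_mono) blast

lemma hutchinson_pow_fixed: "hutchinson I f C = C \<Longrightarrow> (hutchinson I f ^^ n) C = C"
  by (induction n) auto

lemma lower_kuratowski_limit_subset_closed:
  assumes "closed C" "\<And>n. S n \<subseteq> C"
  shows "lower_kuratowski_limit S \<subseteq> C"
  unfolding lower_kuratowski_limit_def using assms closed_sequentially[OF assms(1)] by fast

lemma hutchinson_tri_filled: "hutchinson {1, 2} tri_map tri_filled = tri_filled"
proof -
  have "(\<Union>i\<in>{1, 2}. tri_map i ` tri_filled) = tri_map 1 ` tri_filled \<union> tri_map 2 ` tri_filled"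
    by blast
  also have "\<dots> = tri_filled"
    unfolding tri_map_1_image tri_map_2_image by auto
  finally show ?thesis
    using compact_imp_closed[OF compact_tri_filled] by (simp only: hutchinson_def closure_closed)
qed

lemma zero_in_tri_filled: "0 \<in> tri_filled"
  by (simp add: tri_filled_eq)

lemma semiattractor_tri_filled: "semiattractor {1, 2} tri_map tri_filled"
proof -
  let ?Li = "\<lambda>x. lower_kuratowski_limit (\<lambda>n. (hutchinson {1, 2} tri_map ^^ n) {x})"
  have closed: "closed tri_filled"
    by (rule compact_imp_closed[OF compact_tri_filled])
  \<comment> \<open>A single starting point inside the invariant triangle bounds the whole
    intersection from above.\<close>
  have "?Li 0 \<subseteq> tri_filled"
  proof (rule lower_kuratowski_limit_subset_closed[OF closed])
    fix n
    have "(hutchinson {1, 2} tri_map ^^ n) {0} \<subseteq> (hutchinson {1, 2} tri_map ^^ n) tri_filled"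
      using zero_in_tri_filled by (intro funpow_mono mono_hutchinson) simp
    then show "(hutchinson {1, 2} tri_map ^^ n) {0} \<subseteq> tri_filled"
      by (simp only: hutchinson_pow_fixed[OF hutchinson_tri_filled])
  qed
  moreover have "tri_filled \<subseteq> ?Li x" for x
  proof
    fix a assume a: "a \<in> tri_filled"
    show "a \<in> ?Li x"
    proof (rule mem_lower_kuratowski_limitI)
      fix n
      have "address_comp tri_map (\<lambda>_. 1) n x \<in> (hutchinson {1, 2} tri_map ^^ n) {x}"
        by (rule address_comp_in_hutchinson_pow) auto
      then show "(hutchinson {1, 2} tri_map ^^ n) {x} \<noteq> {}"
        by blast
    next
      fix r :: real assume "r > 0"
      \<comment> \<open>The radius is taken as \<open>norm x\<close>, so that the disc contains the
        starting point.\<close>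
      from ex_address_into_ball[OF a this norm_ge_zero[of x]]
      show "\<forall>\<^sub>F n in sequentially. (hutchinson {1, 2} tri_map ^^ n) {x} \<inter> ball a r \<noteq> {}"
      proof eventually_elim
        case (elim n)
        then obtain s where s: "\<forall>k. s k \<in> {1, 2}" and
          sub: "address_comp tri_map s n ` cball 0 (norm x) \<subseteq> ball a r"
          by blast
        have "address_comp tri_map s n x \<in> ball a r"
          by (intro subsetD[OF sub] imageI) simp
        moreover have "address_comp tri_map s n x \<in> (hutchinson {1, 2} tri_map ^^ n) {x}"
          using s by (intro address_comp_in_hutchinson_pow) auto
        ultimately show ?case
          by blast
      qed
    qed
  qed
  ultimately show ?thesis
    unfolding semiattractor_def using closed ifs_tri_map zero_in_tri_filled
    by (intro conjI antisym INF_greatest INF_lower2) auto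
qed

text \<open>The condition \<open>n \<ge> 1\<close> is recorded because a fibre is an intersection
  over positive lengths.\<close>

lemma ex_address_tri_filled_into_open:
  assumes "a \<in> tri_filled" "open V" "a \<in> V"
  obtains n s where "n \<ge> 1" "\<And>k. s k \<in> {1, 2}" "address_comp tri_map s n ` tri_filled \<subseteq> V"
proof -
  obtain r where r: "r > 0" "ball a r \<subseteq> V"
    using assms openE by blast
  obtain R where R: "R > 0" "tri_filled \<subseteq> cball 0 R"
    using compact_imp_bounded[OF compact_tri_filled] unfolding bounded_pos
    by (metis mem_cball_0 subsetI)
  have "\<forall>\<^sub>F n in sequentially. n \<ge> 1 \<and> (\<exists>s. (\<forall>k. s k \<in> {1, 2}) \<and>
      address_comp tri_map s n ` cball 0 R \<subseteq> ball a r)"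
    using ex_address_into_ball[OF assms(1) r(1)] R by (intro eventually_conj eventually_ge_at_top) auto
  then obtain n s where "n \<ge> 1" "\<And>k. s k \<in> {1, 2}" "address_comp tri_map s n ` cball 0 R \<subseteq> ball a r"
    unfolding eventually_sequentially by blast
  with that r R show thesis
    by (meson image_mono order_trans)
qed

text \<open>A nonempty closed invariant \<open>C\<close> contains the image of each of its points
  under every word. Some such image lands near any given point of the triangle, so \<open>C\<close>
  is dense in the triangle.\<close>

lemma minimal_invariant_tri_filled: "minimal_invariant {1, 2} tri_map tri_filled"
proof -
  have "C = tri_filled" if C: "C \<noteq> {}" "closed C" "C \<subseteq> tri_filled" "hutchinson {1, 2} tri_map C = C" for C
  proof -
    obtain c where c: "c \<in> C"
      using C by blast
    have "a \<in> closure C" if a: "a \<in> tri_filled" for a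
      unfolding closure_iff_nhds_not_empty
    proof (intro allI impI)
      fix A V assume "V \<subseteq> A" "open V" "a \<in> V"
      obtain n s where s: "\<And>k. s k \<in> {1, 2}" "address_comp tri_map s n ` tri_filled \<subseteq> V"
        using ex_address_tri_filled_into_open[OF a \<open>open V\<close> \<open>a \<in> V\<close>] by metis
      have "address_comp tri_map s n c \<in> C"
        using address_comp_in_hutchinson_pow[of s "{1, 2}" c C tri_map n] s(1) c
        unfolding hutchinson_pow_fixed[OF C(4)] by simp
      then show "C \<inter> A \<noteq> {}"
        using s c C(3) \<open>V \<subseteq> A\<close> by blast
    qed
    then show ?thesis
      using C closure_closed by blast
  qed
  then show ?thesis
    unfolding minimal_invariant_def
    using ifs_tri_map hutchinson_tri_filled zero_in_tri_filled compact_imp_closed[OF compact_tri_filled]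
    by blast
qed

text \<open>A fibre lies in each set of its defining intersection, so one initial word that maps the
  triangle into \<open>V\<close> suffices, whatever letters follow.\<close>

lemma strongly_fibred_tri_filled: "strongly_fibred {1, 2} tri_map tri_filled"
proof -
  have "\<exists>s. (\<forall>n\<ge>1. s n \<in> {1, 2}) \<and> fibre tri_map tri_filled s \<subseteq> V"
    if aV: "a \<in> tri_filled" "open V" "a \<in> V" for a V
  proof -
    obtain n s where "n \<ge> 1" "\<And>k. s k \<in> {1, 2}" "address_comp tri_map s n ` tri_filled \<subseteq> V"
      using ex_address_tri_filled_into_open[OF aV] by metis
    then show ?thesis
      unfolding fibre_def by (intro exI[of _ s]) blast
  qed
  then show ?thesis
    unfolding strongly_fibred_def using compact_tri_filled minimal_invariant_tri_filled by blast
qed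

theorem mainTheorem3:
  shows "semiattractor {1, 2} tri_map tri_filled
    \<and> strongly_fibred {1, 2} tri_map tri_filled
    \<and> (\<forall>B\<in>sets borel.
         measure tri_measure B = measure lborel (B \<inter> tri_filled) / measure lborel tri_filled \<and>
         measure tri_measure B = 2 * measure lborel (B \<inter> tri_filled))
    \<and> (\<forall>\<nu>. invariant_measure {1, 2} tri_map (\<lambda>_. 1/2) \<nu> \<longleftrightarrow> \<nu> = tri_measure)"
  using semiattractor_tri_filled strongly_fibred_tri_filled invariant_tri_measure
    invariant_measure_unique
  by (auto simp: measure_tri_measure measure_tri_filled)

end
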